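(* Let $n\geq 2$, $1\leq k\leq n-1$, and $q=p^h$ with $p>5$ prime and $h\geq 1$. There is no codeword $c\in \mathrm{C}_k(n,q)\setminus \mathrm{C}_{n-k}(n,q)^\perp$ whose weight lies in the open interval $]\theta_k, 2q^k[$.
   Context: $\mathrm{PG}(n,q)$ is the $n$-dimensional projective space over $\mathbb{F}_q$, $q=p^h$; $\theta_m=(q^{m+1}-1)/(q-1)$ is the number of points of $\mathrm{PG}(m,q)$. For $1\le j\le n-1$, $\mathrm{C}_j(n,q)$ is the $p$-ary linear code (a subspace of $\mathbb{F}_p^{\theta_n}$, coordinates indexed by the points of $\mathrm{PG}(n,q)$) spanned over $\mathbb{F}_p$ by the incidence vectors of the $j$-dimensional subspaces of $\mathrm{PG}(n,q)$. $(\cdot,\cdot)$ is the standard scalar product over $\mathbb{F}_p$ and $\mathrm{C}_j(n,q)^\perp=\{v : (v,c)=0\ \forall c\in\mathrm{C}_j(n,q)\}$, equivalently the set of $v$ with $(v,J)=0$ for the incidence vector $J$ of every $j$-space. The weight of a vector is its number of nonzero coordinates. *)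

theory Defs
  imports "HOL-Analysis.Analysis"
begin

text \<open>PG(n,q) is modelled via the vector space 'a^'n over a finite field 'a,
  with CARD('n) = n+1. Projective j-subspaces are linear subspaces of
  dimension j+1; points are the 1-dimensional linear subspaces.\<close>

definition proj_subspaces :: "nat \<Rightarrow> ('a::field ^ 'n) set set" where
  "proj_subspaces j = {W. vec.subspace W \<and> vec.dim W = j + 1}"

definition proj_points :: "('a::field ^ 'n) set set" where
  "proj_points = proj_subspaces 0"

definition incvec :: "('a::field ^ 'n) set \<Rightarrow> ('a ^ 'n) set \<Rightarrow> 'a" where
  "incvec W P = (if P \<in> proj_points \<and> P \<subseteq> W then 1 else 0)"

text \<open>The p-ary code C_j(n,q): F_p-span of incidence vectors of j-spaces.
  F_p is the prime subfield of 'a, i.e. the image of of_int.\<close>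
definition code :: "nat \<Rightarrow> (('a::field ^ 'n) set \<Rightarrow> 'a) set" where
  "code j = {v. \<exists>c :: ('a ^ 'n) set \<Rightarrow> int.
      v = (\<lambda>P. \<Sum>W\<in>proj_subspaces j. of_int (c W) * incvec W P)}"

definition ambient :: "(('a::field ^ 'n) set \<Rightarrow> 'a) set" where
  "ambient = {v. (\<forall>P. v P \<in> range of_int) \<and> (\<forall>P. P \<notin> proj_points \<longrightarrow> v P = 0)}"

definition dual_code :: "nat \<Rightarrow> (('a::field ^ 'n) set \<Rightarrow> 'a) set" where
  "dual_code j = {v \<in> ambient. \<forall>W\<in>proj_subspaces j.
      (\<Sum>P\<in>proj_points. v P * incvec W P) = 0}"

definition weight :: "(('a::field ^ 'n) set \<Rightarrow> 'a) \<Rightarrow> nat" where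
  "weight v = card {P \<in> proj_points. v P \<noteq> 0}"

definition theta :: "nat \<Rightarrow> nat \<Rightarrow> nat" where
  "theta q m = (q ^ (m + 1) - 1) div (q - 1)"

end

theory Submission
  imports Defs
begin

text \<open>
  Read a codeword \<open>c\<close> as a function \<open>F\<close> on vectors that is constant on punctured lines through the
  origin. A \<open>k\<close>-space meets every additive subgroup \<open>U\<close> with more than \<open>q ^ (n - k)\<close> elements in a
  nontrivial \<open>p\<close>-group, so \<open>F\<close> sums to the same value \<open>- \<alpha>\<close> over all such \<open>U\<close>, and \<open>\<alpha> \<noteq> 0\<close> because
  \<open>c\<close> is not in the dual code.

  First, \<open>F\<close> only takes the values \<open>0\<close> and \<open>\<alpha>\<close>. If a point \<open>r\<close> had another value, then, as the weight is
  below \<open>2 q ^ k\<close>, counting gives an \<open>(n - k)\<close>-space \<open>S\<close> through \<open>r\<close> that contains exactly one more point \<open>z\<close> of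
  the support. In each \<open>(n - k + 1)\<close>-space through \<open>S\<close>, the support outside \<open>S\<close> meets every
  hyperplane that does not contain both \<open>r\<close> and \<open>z\<close>; by the polynomial method of Jamison and
  Brouwer--Schrijver it has at least \<open>2 (q - 1)\<close> points there, which adds up to weight at least \<open>2 q ^ k\<close>.

  Hence the support, regarded as a point set over the prime field, meets every large enough subgroup in
  \<open>1\<close> modulo \<open>p\<close> points. Counting extensions of an \<open>F\<^sub>p\<close>-line shows that a line with two points of the support
  has at least \<open>p - 1\<close> of them, and then that it has all of its \<open>p + 1\<close> points. So the support is a subspace,
  and its weight is at most \<open>\<theta>\<^sub>k\<close>.
\<close>

section \<open>Subspaces over a subfield, counted by cardinality\<close>

lemma CARD_ge_2: "CARD('a::{zero_neq_one,finite}) \<ge> 2"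
proof -
  have "card {0, 1 :: 'a} \<le> CARD('a)"
    by (rule card_mono) auto
  then show ?thesis by simp
qed

text \<open>\<open>K\<close> will be the whole field (\<open>fq\<close>) and the prime subfield
  (\<open>fp\<close>), so each counting argument is proved once for both. Cardinalities, which are
  powers of \<open>card K\<close>, take the place of dimensions.\<close>

locale scalar_subfield =
  fixes K :: "'a::{field,finite} set"
  assumes one_K: "1 \<in> K"
    and diff_K: "\<And>x y. x \<in> K \<Longrightarrow> y \<in> K \<Longrightarrow> x - y \<in> K"
    and mult_K: "\<And>x y. x \<in> K \<Longrightarrow> y \<in> K \<Longrightarrow> x * y \<in> K"
    and inverse_K: "\<And>x. x \<in> K \<Longrightarrow> inverse x \<in> K"
begin

lemma zero_K: "0 \<in> K"
  using diff_K[OF one_K one_K] by simp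

lemma uminus_K: "x \<in> K \<Longrightarrow> - x \<in> K"
  using diff_K[OF zero_K] by force

lemma add_K: "x \<in> K \<Longrightarrow> y \<in> K \<Longrightarrow> x + y \<in> K"
  using diff_K[of x "- y"] uminus_K by simp

lemma card_K_ge_2: "card K \<ge> 2"
proof -
  have "card {0, 1 :: 'a} \<le> card K"
    by (rule card_mono) (auto simp: zero_K one_K)
  then show ?thesis by simp
qed

definition ksub :: "('a ^ 'n) set \<Rightarrow> bool" where
  "ksub U \<longleftrightarrow> 0 \<in> U \<and> (\<forall>u\<in>U. \<forall>w\<in>U. u + w \<in> U) \<and> (\<forall>t\<in>K. \<forall>u\<in>U. t *s u \<in> U)"

definition ext :: "('a ^ 'n) set \<Rightarrow> 'a ^ 'n \<Rightarrow> ('a ^ 'n) set" where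
  "ext U v = (\<lambda>(u, t). u + t *s v) ` (U \<times> K)"

text \<open>A union of punctured lines over \<open>K\<close>, that is, a set of points of the
  projective space over \<open>K\<close> given by all their nonzero representatives.\<close>

definition cone :: "('a ^ 'n) set \<Rightarrow> bool" where
  "cone Z \<longleftrightarrow> 0 \<notin> Z \<and> (\<forall>t\<in>K. \<forall>z\<in>Z. t \<noteq> 0 \<longrightarrow> t *s z \<in> Z)"

lemma ksub_zero: "ksub U \<Longrightarrow> 0 \<in> U"
  and ksub_add: "ksub U \<Longrightarrow> u \<in> U \<Longrightarrow> w \<in> U \<Longrightarrow> u + w \<in> U"
  and ksub_scale: "ksub U \<Longrightarrow> t \<in> K \<Longrightarrow> u \<in> U \<Longrightarrow> t *s u \<in> U"
  by (auto simp: ksub_def)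

lemma ksub_uminus: "ksub U \<Longrightarrow> u \<in> U \<Longrightarrow> - u \<in> U"
  using ksub_scale[of U "-1" u] uminus_K[OF one_K]
  by (metis vector_sneg_minus1)

lemma ksub_diff: "ksub U \<Longrightarrow> u \<in> U \<Longrightarrow> w \<in> U \<Longrightarrow> u - w \<in> U"
  using ksub_add[of U u "- w"] ksub_uminus[of U w] by simp

lemma ksub_scale_iff:
  assumes "ksub U" "t \<in> K" "t \<noteq> 0" shows "t *s u \<in> U \<longleftrightarrow> u \<in> U"
  using ksub_scale[OF assms(1) inverse_K[OF assms(2)], of "t *s u"] ksub_scale[OF assms(1,2)] assms(3)
  by auto

lemma ksub_Int: "ksub U \<Longrightarrow> ksub W \<Longrightarrow> ksub (U \<inter> W)"
  by (auto simp: ksub_def)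

lemma ksub_singleton_0: "ksub {0}"
  by (simp add: ksub_def)

lemma extI: "u \<in> U \<Longrightarrow> t \<in> K \<Longrightarrow> u + t *s v \<in> ext U v"
  by (auto simp: ext_def)

lemma extE:
  assumes "x \<in> ext U v" obtains u t where "u \<in> U" "t \<in> K" "x = u + t *s v"
  using assms by (auto simp: ext_def)

lemma subset_ext: "U \<subseteq> ext U v"
proof
  fix u assume "u \<in> U"
  then show "u \<in> ext U v" using extI[OF _ zero_K, of u U v] by simp
qed

lemma vec_in_ext: "ksub U \<Longrightarrow> v \<in> ext U v"
  using extI[OF ksub_zero one_K, of U v] by simp

lemma ksub_ext:
  assumes U: "ksub U" shows "ksub (ext U v)"
  unfolding ksub_def
proof (intro conjI ballI)
  show "0 \<in> ext U v" using subset_ext ksub_zero[OF U] by blast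
next
  fix x y assume "x \<in> ext U v" "y \<in> ext U v"
  then obtain u t u' t' where *: "u \<in> U" "t \<in> K" "x = u + t *s v" "u' \<in> U" "t' \<in> K" "y = u' + t' *s v"
    by (metis extE)
  have "x + y = (u + u') + (t + t') *s v" using * by (simp add: vector_sadd_rdistrib)
  then show "x + y \<in> ext U v" using * extI ksub_add[OF U] add_K by metis
next
  fix s x assume s: "s \<in> K" and "x \<in> ext U v"
  then obtain u t where *: "u \<in> U" "t \<in> K" "x = u + t *s v"
    by (metis extE)
  have "s *s x = s *s u + (s * t) *s v" using * by (simp add: vector_add_ldistrib)
  then show "s *s x \<in> ext U v" using * s extI ksub_scale[OF U] mult_K by metis
qed

lemma ext_subset: "ksub X \<Longrightarrow> U \<subseteq> X \<Longrightarrow> v \<in> X \<Longrightarrow> ext U v \<subseteq> X"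
  by (auto elim!: extE simp: ksub_add ksub_scale subset_iff)

lemma ext_coords_unique:
  assumes U: "ksub U" and v: "v \<notin> U" and u: "u \<in> U" "u' \<in> U" and t: "t \<in> K" "t' \<in> K"
    and eq: "u + t *s v = u' + t' *s v"
  shows "u = u' \<and> t = t'"
proof -
  have "(t - t') *s v = u' - u" using eq by (simp add: vector_ssub_ldistrib vec.scale_left_diff_distrib algebra_simps)
  then have "(t - t') *s v \<in> U" using ksub_diff[OF U u(2) u(1)] by simp
  then have "t = t'" using ksub_scale_iff[OF U diff_K[OF t], of v] v by auto
  then show ?thesis using eq by simp
qed

lemma card_ext:
  assumes "ksub U" "v \<notin> U" shows "card (ext U v) = card U * card K"
proof -
  have "inj_on (\<lambda>(u, t). u + t *s v) (U \<times> K)"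
    using ext_coords_unique[OF assms] by (auto simp: inj_on_def)
  then show ?thesis unfolding ext_def by (simp add: card_image card_cartesian_product)
qed

section \<open>Counting one-step extensions of a subspace against a cone\<close>

lemma ext_exchange:
  assumes U: "ksub U" and z: "z \<notin> U" "z \<in> ext U v" shows "v \<in> ext U z"
proof -
  obtain u t where *: "u \<in> U" "t \<in> K" "z = u + t *s v" using z(2) by (metis extE)
  have t0: "t \<noteq> 0" using * z(1) by auto
  have "v = - (inverse t *s u) + inverse t *s z"
    using t0 by (simp add: * vector_add_ldistrib)
  then show ?thesis
    using extI[OF ksub_uminus[OF U ksub_scale[OF U inverse_K[OF *(2)] *(1)]] inverse_K[OF *(2)], of z]
    by simp
qed

text \<open>Double counting over pairs \<open>(v, z)\<close> with \<open>z \<in> ext U v\<close>: by the exchange property every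
  \<open>z \<notin> U\<close> lies in the extension by exactly \<open>card U * (card K - 1)\<close> vectors \<open>v \<notin> U\<close>.\<close>
lemma card_ge_if_extensions_rich:
  fixes U :: "('a ^ 'n) set"
  assumes U: "ksub U" and rich: "\<And>v. v \<notin> U \<Longrightarrow> t \<le> card (Z \<inter> (ext U v - U))"
  shows "t * (CARD('a ^ 'n) - card U) \<le> card (Z - U) * (card U * (card K - 1))"
proof -
  have "t * (CARD('a ^ 'n) - card U) = (\<Sum>v\<in>- U. t)"
    by (simp add: card_Diff_subset Compl_eq_Diff_UNIV Groups.mult_ac)
  also have "\<dots> \<le> (\<Sum>v\<in>- U. card {z \<in> Z - U. z \<in> ext U v})"
  proof (rule sum_mono)
    fix v assume "v \<in> - U"
    moreover have "{z \<in> Z - U. z \<in> ext U v} = Z \<inter> (ext U v - U)" by auto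
    ultimately show "t \<le> card {z \<in> Z - U. z \<in> ext U v}" using rich by simp
  qed
  also have "\<dots> = (\<Sum>z\<in>Z - U. card {v \<in> - U. z \<in> ext U v})"
    by (rule sum_multicount_gen) auto
  also have "\<dots> = (\<Sum>z\<in>Z - U. card U * (card K - 1))"
  proof (rule sum.cong)
    fix z assume z: "z \<in> Z - U"
    have "{v \<in> - U. z \<in> ext U v} = ext U z - U"
      using ext_exchange[OF U] z by auto
    then have "card {v \<in> - U. z \<in> ext U v} = card U * card K - card U"
      using card_ext[OF U, of z] z by (simp add: card_Diff_subset subset_ext)
    then show "card {v \<in> - U. z \<in> ext U v} = card U * (card K - 1)"
      by (simp add: diff_mult_distrib2)
  qed simp
  finally show ?thesis by simp
qed

lemma card_line_minus_0:
  assumes "v \<noteq> 0" shows "card ((\<lambda>t. t *s v) ` (K - {0})) = card K - 1"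
proof -
  have "inj_on (\<lambda>t. t *s v) (K - {0})" using assms by (auto simp: inj_on_def)
  then show ?thesis using card_image zero_K by (metis card_Diff_singleton)
qed

lemma cone_Int_Diff: "cone Z \<Longrightarrow> ksub U \<Longrightarrow> ksub W \<Longrightarrow> cone (Z \<inter> (W - U))"
  unfolding cone_def using ksub_scale_iff by blast

text \<open>Proportionality over \<open>K\<close> partitions the cone into punctured lines of
  \<open>card K - 1\<close> vectors each.\<close>

lemma cone_card_dvd:
  assumes Z: "cone Z" shows "card K - 1 dvd card Z"
proof -
  define r where "r = {(x, y). x \<in> Z \<and> y \<in> Z \<and> (\<exists>t\<in>K. t \<noteq> 0 \<and> y = t *s x)}"
  have "equiv Z r"
  proof (rule equivI)
    show "r \<subseteq> Z \<times> Z" by (auto simp: r_def)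
    show "refl_on Z r" using one_K by (auto simp: r_def refl_on_def intro!: bexI[of _ 1])
    show "sym r" unfolding sym_def r_def
    proof safe
      fix x t assume "t \<in> K" "t \<noteq> 0"
      then show "\<exists>s\<in>K. s \<noteq> 0 \<and> x = s *s (t *s x)"
        by (intro bexI[of _ "inverse t"]) (auto intro: inverse_K)
    qed
    show "trans r" unfolding trans_def r_def
    proof safe
      fix x t s assume "t \<in> K" "s \<in> K" "t \<noteq> 0" "s \<noteq> 0"
      then show "\<exists>m\<in>K. m \<noteq> 0 \<and> t *s (s *s x) = m *s x"
        by (intro bexI[of _ "t * s"]) (auto intro: mult_K)
    qed
  qed
  moreover have "card K - 1 dvd card X" if X: "X \<in> Z // r" for X
  proof -
    obtain x where x: "x \<in> Z" "X = r `` {x}" using X by (auto simp: quotient_def)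
    have "X = (\<lambda>t. t *s x) ` (K - {0})"
      using x Z by (auto simp: r_def cone_def)
    moreover have "x \<noteq> 0" using x Z by (auto simp: cone_def)
    ultimately show ?thesis by (simp add: card_line_minus_0)
  qed
  ultimately show ?thesis by (intro equiv_imp_dvd_card[of Z r]) auto
qed

text \<open>If every extension gained a vector of \<open>Z\<close>, it would gain a whole punctured
  line, and double counting would give
  \<open>CARD('a ^ 'n) \<le> (card Z + 1) * card U\<close>.\<close>

lemma extend_avoiding_cone:
  fixes U :: "('a ^ 'n) set"
  assumes U: "ksub U" and Z: "cone Z" and small: "(card Z + 1) * card U < CARD('a ^ 'n)"
  shows "\<exists>v. v \<notin> U \<and> Z \<inter> ext U v = Z \<inter> U"
proof (rule ccontr)
  assume "\<not> ?thesis"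
  then have *: "\<And>v. v \<notin> U \<Longrightarrow> Z \<inter> ext U v \<noteq> Z \<inter> U" by blast
  have "card K - 1 \<le> card (Z \<inter> (ext U v - U))" if v: "v \<notin> U" for v
  proof -
    have "Z \<inter> (ext U v - U) \<noteq> {}" using *[OF v] subset_ext by blast
    then have "card (Z \<inter> (ext U v - U)) > 0" by (simp add: card_gt_0_iff)
    moreover have "card K - 1 dvd card (Z \<inter> (ext U v - U))"
      by (intro cone_card_dvd cone_Int_Diff Z U ksub_ext)
    ultimately show ?thesis by (simp add: dvd_imp_le)
  qed
  from card_ge_if_extensions_rich[OF U this]
  have "(card K - 1) * (CARD('a ^ 'n) - card U) \<le> (card K - 1) * (card (Z - U) * card U)"
    by (simp add: Groups.mult_ac)
  then have "CARD('a ^ 'n) - card U \<le> card (Z - U) * card U"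
    using card_K_ge_2 by simp
  also have "\<dots> \<le> card Z * card U"
    by (intro mult_right_mono card_mono) auto
  finally show False using small by (simp add: algebra_simps)
qed

text \<open>Iteration of \<open>extend_avoiding_cone\<close>; it supplies large subspaces whose part
  in \<open>Z\<close> is still known exactly.\<close>

lemma grow_avoiding_cone:
  fixes U :: "('a ^ 'n) set"
  assumes Z: "cone Z" and U: "ksub U" "card U = card K ^ i" and ij: "i \<le> j"
    and small: "\<And>m. m < j \<Longrightarrow> (card Z + 1) * card K ^ m < CARD('a ^ 'n)"
  shows "\<exists>U'. ksub U' \<and> U \<subseteq> U' \<and> card U' = card K ^ j \<and> Z \<inter> U' = Z \<inter> U"
  using ij small
proof (induction j rule: dec_induct)
  case base
  then show ?case using U by blast
next
  case (step j)
  then obtain U' where U': "ksub U'" "U \<subseteq> U'" "card U' = card K ^ j" "Z \<inter> U' = Z \<inter> U"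
    by (meson less_SucI)
  obtain v where v: "v \<notin> U'" "Z \<inter> ext U' v = Z \<inter> U'"
    using extend_avoiding_cone[OF U'(1) Z] step.prems[of j] U'(3) by auto
  then have "ksub (ext U' v) \<and> U \<subseteq> ext U' v \<and> card (ext U' v) = card K ^ Suc j \<and> Z \<inter> ext U' v = Z \<inter> U"
    using ksub_ext card_ext U' subset_ext by (metis power_Suc2 subset_trans)
  then show ?case by blast
qed

section \<open>Cardinalities of subspaces and of their intersections\<close>

lemma ksub_card_power:
  assumes X: "ksub X" shows "\<exists>m. card X = card K ^ m"
proof -
  define \<F> where "\<F> = {Y. Y \<subseteq> X \<and> ksub Y \<and> (\<exists>m. card Y = card K ^ m)}"
  have "{0} \<in> \<F>" using ksub_singleton_0 ksub_zero[OF X] by (auto simp: \<F>_def intro: exI[of _ 0])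
  moreover have "finite \<F>" by simp
  ultimately obtain Y where Y: "Y \<in> \<F>" "\<And>Y'. Y' \<in> \<F> \<Longrightarrow> Y \<subseteq> Y' \<Longrightarrow> Y' = Y"
    using finite_has_maximal[of \<F>] by blast
  have "Y = X"
  proof (rule ccontr)
    assume "Y \<noteq> X"
    then obtain v where v: "v \<in> X" "v \<notin> Y" using Y by (auto simp: \<F>_def)
    obtain m where m: "card Y = card K ^ m" "ksub Y" "Y \<subseteq> X" using Y by (auto simp: \<F>_def)
    have "card (ext Y v) = card K ^ Suc m" using card_ext[OF m(2) v(2)] m by simp
    then have "ext Y v \<in> \<F>"
      using ext_subset[OF X m(3) v(1)] ksub_ext[OF m(2)] unfolding \<F>_def by blast
    then have "ext Y v = Y" using Y(2) subset_ext by blast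
    then show False using vec_in_ext[OF m(2)] v by blast
  qed
  then show ?thesis using Y by (auto simp: \<F>_def)
qed

text \<open>Pigeonhole in place of the dimension formula: there are more pairs than vectors, so two
  differences \<open>u - w\<close> agree and yield a nonzero common vector; a nonzero subspace has a
  positive power of \<open>card K\<close> elements.\<close>

lemma card_dvd_card_ksub_Int:
  fixes U W :: "('a ^ 'n) set"
  assumes U: "ksub U" and W: "ksub W" and big: "CARD('a ^ 'n) < card U * card W"
  shows "card K dvd card (U \<inter> W)"
proof -
  have "\<not> inj_on (\<lambda>(u, w). u - w) (U \<times> W)"
  proof
    assume "inj_on (\<lambda>(u, w). u - w) (U \<times> W)"
    then have "card (U \<times> W) \<le> CARD('a ^ 'n)" by (rule card_inj_on_le) auto
    then show False using big by (simp add: card_cartesian_product)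
  qed
  then obtain u w u' w' where *: "u \<in> U" "w \<in> W" "u' \<in> U" "w' \<in> W" "u - w = u' - w'" "(u, w) \<noteq> (u', w')"
    by (auto simp: inj_on_def)
  have eq: "u - u' = w - w'" using *(5) by (simp add: algebra_simps)
  have ne: "u - u' \<noteq> 0" using *(6) eq by auto
  have "u - u' \<in> U \<inter> W" using ksub_diff[OF U *(1,3)] ksub_diff[OF W *(2,4)] eq by auto
  then have "{0, u - u'} \<subseteq> U \<inter> W" using ksub_zero[OF U] ksub_zero[OF W] by auto
  then have "card {0, u - u'} \<le> card (U \<inter> W)" by (intro card_mono) auto
  then have "card (U \<inter> W) \<ge> 2" using ne by simp
  moreover obtain m where "card (U \<inter> W) = card K ^ m" using ksub_card_power[OF ksub_Int[OF U W]] by blast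
  ultimately show ?thesis by (cases m) auto
qed

end

section \<open>Finite fields\<close>

interpretation fq: scalar_subfield "UNIV :: 'a::{field,finite} set"
  by standard auto

lemma of_nat_CARD_eq_0: "of_nat CARD('a) = (0 :: 'a::{field,finite})"
proof -
  have "(\<Sum>x\<in>UNIV. x + 1) = (\<Sum>x\<in>UNIV. x :: 'a)"
    by (rule sum.reindex_bij_witness[of _ "\<lambda>x. x - 1" "\<lambda>x. x + 1"]) auto
  then show ?thesis by (simp add: sum.distrib)
qed

lemma CHAR_finite_field_pos: "CHAR('a::{field,finite}) > 0"
  by (rule finite_imp_CHAR_pos) simp

interpretation fp: scalar_subfield "range of_int :: 'a::{field,finite} set"
proof
  show "1 \<in> (range of_int :: 'a set)" by (metis of_int_1 rangeI)
  show minus: "x - y \<in> (range of_int :: 'a set)" if "x \<in> range of_int" "y \<in> range of_int" for x y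
    using that by (metis (no_types, lifting) imageE of_int_diff rangeI)
  show mult: "x * y \<in> (range of_int :: 'a set)" if "x \<in> range of_int" "y \<in> range of_int" for x y
    using that by (metis (no_types, lifting) imageE of_int_mult rangeI)
  show "inverse x \<in> (range of_int :: 'a set)" if x: "x \<in> range of_int" for x
  proof (cases "x = 0")
    case True
    then show ?thesis using x by simp
  next
    case False
    \<comment> \<open>Multiplication by \<open>x\<close> is injective on a finite set, hence onto,
      so 1 is a multiple of \<open>x\<close> there.\<close>
    have "(*) x ` range of_int = (range of_int :: 'a set)"
      using False mult[OF x] by (intro endo_inj_surj) (auto simp: inj_on_def)
    moreover have "1 \<in> (range of_int :: 'a set)" by (metis of_int_1 rangeI)
    ultimately obtain y where "y \<in> (range of_int :: 'a set)" "1 = x * y" by (metis imageE)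
    then show ?thesis by (metis inverse_unique)
  qed
qed

lemma card_range_of_int: "card (range of_int :: 'a::{field,finite} set) = CHAR('a)"
proof -
  let ?p = "CHAR('a)"
  have "range of_int = (of_nat ` {..<?p} :: 'a set)"
  proof (intro equalityI subsetI)
    fix x :: 'a assume "x \<in> range of_int"
    then obtain i where i: "x = of_int i" by auto
    have "of_int (i - i mod int ?p) = (0 :: 'a)"
      by (subst of_int_eq_0_iff_char_dvd) (simp add: minus_mod_eq_mult_div)
    then have "x = of_int (i mod int ?p)" using i by simp
    also have "i mod int ?p = int (nat (i mod int ?p))" using CHAR_finite_field_pos[where 'a='a] by simp
    also have "of_int \<dots> = (of_nat (nat (i mod int ?p)) :: 'a)" by simp
    finally have "x = of_nat (nat (i mod int ?p))" .
    moreover have "nat (i mod int ?p) < ?p"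
      using CHAR_finite_field_pos[where 'a='a] by (simp add: nat_less_iff)
    ultimately show "x \<in> of_nat ` {..<?p}" by blast
  next
    fix x :: 'a assume "x \<in> of_nat ` {..<?p}"
    then show "x \<in> range of_int" by (metis imageE of_int_of_nat_eq rangeI)
  qed
  moreover have "inj_on (of_nat :: nat \<Rightarrow> 'a) {..<?p}"
  proof (rule linorder_inj_onI)
    fix x y :: nat assume xy: "x < y" "y \<in> {..<?p}"
    show "of_nat x \<noteq> (of_nat y :: 'a)"
    proof
      assume "of_nat x = (of_nat y :: 'a)"
      then have "of_nat (y - x) = (0 :: 'a)" using xy by (simp add: of_nat_diff)
      then have "?p dvd y - x" by (simp add: of_nat_eq_0_iff_char_dvd)
      then show False using xy by (auto dest!: dvd_imp_le)
    qed
  qed auto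
  ultimately show ?thesis by (simp add: card_image)
qed

lemma fq_ksub_imp_fp_ksub: "fq.ksub U \<Longrightarrow> fp.ksub U"
  by (auto simp: fq.ksub_def fp.ksub_def)

section \<open>Power sums and the polynomial method\<close>

text \<open>For \<open>i > 0\<close>, replacing \<open>x\<close> by \<open>g * x\<close> multiplies
  the sum by \<open>g ^ i\<close>, and some nonzero \<open>g\<close> has
  \<open>g ^ i \<noteq> 1\<close> because \<open>x ^ i - 1\<close> has at most \<open>i\<close>
  roots.\<close>

lemma sum_power_finite_field:
  assumes i: "i < CARD('a) - 1"
  shows "(\<Sum>x\<in>UNIV. x ^ i) = (0 :: 'a::{field,finite})"
proof (cases "i = 0")
  case True
  then show ?thesis by (simp add: of_nat_CARD_eq_0)
next
  case False
  have "\<exists>g::'a. g \<noteq> 0 \<and> g ^ i \<noteq> 1"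
  proof (rule ccontr)
    assume "\<not> ?thesis"
    then have all: "\<And>g::'a. g \<noteq> 0 \<Longrightarrow> g ^ i = 1" by blast
    define f :: "'a poly" where "f = monom 1 i - 1"
    have "coeff f i = 1" using False by (simp add: f_def)
    then have "f \<noteq> 0" by auto
    have "degree f \<le> i" unfolding f_def by (intro degree_diff_le) (auto simp: degree_monom_le)
    moreover have "card {x. poly f x = 0} \<le> degree f"
      using \<open>f \<noteq> 0\<close> by (rule card_poly_roots_bound)
    moreover have "card (UNIV - {0 :: 'a}) \<le> card {x. poly f x = 0}"
      by (rule card_mono) (auto simp: f_def poly_monom all)
    moreover have "card (UNIV - {0 :: 'a}) = CARD('a) - 1" by (simp add: card_Diff_singleton)
    ultimately show False using i by linarith
  qed
  then obtain g :: 'a where g: "g \<noteq> 0" "g ^ i \<noteq> 1" by blast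
  have "(\<Sum>x\<in>UNIV. x ^ i) = (\<Sum>x\<in>UNIV. (g * x) ^ i)"
    by (rule sum.reindex_bij_witness[of _ "\<lambda>x. g * x" "\<lambda>x. x / g"]) (auto simp: g)
  also have "\<dots> = g ^ i * (\<Sum>x\<in>UNIV. x ^ i)"
    by (simp add: power_mult_distrib sum_distrib_left)
  finally have "(g ^ i - 1) * (\<Sum>x\<in>UNIV. x ^ i) = 0" by (simp add: algebra_simps)
  then show ?thesis using g by simp
qed

text \<open>The expanded polynomial has total degree below \<open>2 * (CARD('a) - 1)\<close>, so
  each monomial has an exponent below \<open>CARD('a) - 1\<close> and sums to 0. The factor
  \<open>x ^ i * y ^ j\<close> lets the induction split off one affine form at a time.\<close>

lemma sum_monomial_times_affine_forms:
  fixes f g :: "'b \<Rightarrow> 'a::{field,finite}"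
  assumes "finite A" "i + j + card A < 2 * (CARD('a) - 1)"
  shows "(\<Sum>x\<in>UNIV. \<Sum>y\<in>UNIV. x ^ i * y ^ j * (\<Prod>s\<in>A. 1 - x * f s - y * g s)) = 0"
  using assms
proof (induction A arbitrary: i j rule: finite_induct)
  case empty
  have "(\<Sum>x\<in>UNIV. \<Sum>y\<in>UNIV. x ^ i * y ^ j) = (\<Sum>x\<in>UNIV. x ^ i) * (\<Sum>y\<in>UNIV. y ^ j :: 'a)"
    by (simp add: sum_product)
  moreover have "i < CARD('a) - 1 \<or> j < CARD('a) - 1" using empty by auto
  ultimately show ?case using sum_power_finite_field[where 'a='a] by auto
next
  case (insert a A)
  let ?P = "\<lambda>x y. \<Prod>s\<in>A. 1 - x * f s - y * g s"
  have "(\<Sum>x\<in>UNIV. \<Sum>y\<in>UNIV. x ^ i * y ^ j * (\<Prod>s\<in>insert a A. 1 - x * f s - y * g s))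
    = (\<Sum>x\<in>UNIV. \<Sum>y\<in>UNIV. x ^ i * y ^ j * ?P x y - f a * (x ^ Suc i * y ^ j * ?P x y)
        - g a * (x ^ i * y ^ Suc j * ?P x y))"
    using insert(1,2) by (simp add: algebra_simps)
  also have "\<dots> = (\<Sum>x\<in>UNIV. \<Sum>y\<in>UNIV. x ^ i * y ^ j * ?P x y)
      - f a * (\<Sum>x\<in>UNIV. \<Sum>y\<in>UNIV. x ^ Suc i * y ^ j * ?P x y)
      - g a * (\<Sum>x\<in>UNIV. \<Sum>y\<in>UNIV. x ^ i * y ^ Suc j * ?P x y)"
    by (simp only: sum_subtractf sum_distrib_left)
  also have "\<dots> = 0"
    using insert by (simp del: power_Suc)
  finally show ?case .
qed

text \<open>The two-dimensional case of the theorem of Jamison and Brouwer--Schrijver on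
  sets of points meeting all hyperplanes that avoid the origin.\<close>
lemma card_ge_if_affine_forms_cover:
  fixes f g :: "'b \<Rightarrow> 'a::{field,finite}"
  assumes A: "finite A"
    and cover: "\<And>x y. (x, y) \<noteq> (0, 0) \<Longrightarrow> \<exists>s\<in>A. x * f s + y * g s = 1"
  shows "2 * (CARD('a) - 1) \<le> card A"
proof (rule ccontr)
  assume small: "\<not> ?thesis"
  let ?P = "\<lambda>x y. \<Prod>s\<in>A. 1 - x * f s - y * g s"
  have zero: "?P x y = 0" if xy: "(x, y) \<noteq> (0, 0)" for x y
  proof -
    obtain s where "s \<in> A" "x * f s + y * g s = 1" using cover[OF xy] by blast
    then have "s \<in> A \<and> 1 - x * f s - y * g s = 0" by (simp add: algebra_simps)
    then show ?thesis using A by (auto simp: prod_zero_iff)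
  qed
  \<comment> \<open>Only the origin survives the covering condition and it contributes 1, whereas
    the degree bound makes the sum 0.\<close>
  have "(\<Sum>x\<in>UNIV. \<Sum>y\<in>UNIV. ?P x y) = (\<Sum>x\<in>UNIV. if x = 0 then (\<Sum>y\<in>UNIV. ?P x y) else 0)"
    using zero by (intro sum.cong) auto
  also have "\<dots> = (\<Sum>y\<in>UNIV. ?P 0 y)" by (simp add: sum.delta)
  also have "\<dots> = (\<Sum>y\<in>(UNIV :: 'a set). if y = 0 then 1 else 0)"
    using zero[of 0] by (intro sum.cong) auto
  also have "\<dots> = 1" by (simp add: sum.delta)
  finally have "(\<Sum>x\<in>UNIV. \<Sum>y\<in>UNIV. ?P x y) = 1" .
  then show False
    using sum_monomial_times_affine_forms[OF A, of 0 0 f g] small by simp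
qed

lemma CARD_eq_CHAR_power: "\<exists>h. CARD('a::{field,finite}) = CHAR('a) ^ h"
  \<comment> \<open>Vectors with a single coordinate stand for the field as a space over its prime
    field.\<close>
  using fp.ksub_card_power[of "UNIV :: ('a ^ 1) set"]
  by (simp add: fp.ksub_def card_range_of_int)

text \<open>As \<open>w * (p - 1) + 1 = w * p - (w - 1)\<close>, divisibility means that
  \<open>w\<close> is 1 modulo \<open>p\<close>. In use, \<open>w\<close> counts points over F_p,
  each made of \<open>p - 1\<close> vectors.\<close>

lemma large_if_dvd_mult_pred:
  fixes p w :: nat
  assumes "p dvd w * (p - 1) + 1" "2 \<le> w" "2 \<le> p" shows "p + 1 \<le> w"
proof -
  have "w * (p - 1) + 1 + (w - 1) = w * p"
    using assms(2,3) by (cases p; cases w) auto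
  then have "p dvd w - 1" using assms(1) by (metis dvd_add_right_iff dvd_triv_right)
  then have "p \<le> w - 1" using assms(2) by (intro dvd_imp_le) auto
  then show ?thesis using assms(2) by linarith
qed

section \<open>Light codewords as functions on vectors\<close>

text \<open>Provides two coordinates such that no form \<open>x * s $ i + y * s $ j\<close> other
  than 0 vanishes at both \<open>r\<close> and \<open>z\<close>.\<close>

lemma independent_minor:
  fixes r z :: "'a::field ^ 'n"
  assumes r: "r \<noteq> 0" and z: "\<And>t. z \<noteq> t *s r"
  obtains i j where "r $ i * z $ j \<noteq> r $ j * z $ i"
proof -
  obtain i where i: "r $ i \<noteq> 0" using r by (auto simp: vec_eq_iff)
  obtain j where "z $ j \<noteq> (z $ i / r $ i) * r $ j"
    using z[of "z $ i / r $ i"] by (auto simp: vec_eq_iff)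
  then have "r $ i * z $ j \<noteq> r $ j * z $ i" using i by (auto simp: field_simps)
  then show thesis by (rule that)
qed

text \<open>A codeword of \<open>C_k(n,q)\<close>, with \<open>n = k + m\<close>, seen as a function \<open>F\<close> on vectors; \<open>\<alpha>\<close> is its
  scalar product with every \<open>m\<close>-space. The assumption \<open>sum_F\<close> covers additive subgroups, that is,
  \<open>F\<^sub>p\<close>-linear sets, and not just subspaces over the whole field.\<close>
locale light_codeword =
  fixes F :: "'a::{field,finite} ^ 'n \<Rightarrow> 'a" and \<alpha> :: 'a and k m :: nat
  assumes F_scale: "\<And>t v. t \<noteq> 0 \<Longrightarrow> F (t *s v) = F v"
    and F_0: "F 0 = 0"
    and \<alpha>_nz: "\<alpha> \<noteq> 0"
    and sum_F: "\<And>U. fp.ksub U \<Longrightarrow> CARD('a) ^ m < card U \<Longrightarrow> sum F U = - \<alpha>"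
    and dim: "CARD('n) = k + m + 1" and m_pos: "1 \<le> m"
    and char_ge_5: "5 \<le> CHAR('a)"
    and light: "card {v. F v \<noteq> 0} < 2 * CARD('a) ^ k * (CARD('a) - 1)"
begin

abbreviation Z :: "('a ^ 'n) set" where "Z \<equiv> {v. F v \<noteq> 0}"
abbreviation line0 :: "'a ^ 'n \<Rightarrow> ('a ^ 'n) set" where "line0 v \<equiv> (\<lambda>t. t *s v) ` (UNIV - {0})"

lemma q_ge_2: "CARD('a) \<ge> 2" by (rule CARD_ge_2)

lemma CARD_V: "CARD('a ^ 'n) = CARD('a) ^ k * CARD('a) ^ m * CARD('a)"
  by (simp add: dim power_add Groups.mult_ac)

lemma fq_cone_Z: "fq.cone Z"
  by (auto simp: fq.cone_def F_0 F_scale)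

text \<open>The size condition of \<open>extend_avoiding_cone\<close> for the support. The slack
  \<open>c\<close>, in use \<open>q = CARD('a)\<close> or \<open>p = CHAR('a)\<close>, absorbs the
  factor 2 of the weight bound.\<close>

lemma Z_subspace_product_small:
  assumes x: "x * c \<le> CARD('a) ^ m" and c: "2 \<le> c"
  shows "(card Z + 1) * x < CARD('a ^ 'n)"
proof (cases "x = 0")
  case True
  then show ?thesis by (simp add: CARD_V)
next
  case False
  have "(card Z + 1) * x * c \<le> (2 * CARD('a) ^ k * (CARD('a) - 1)) * CARD('a) ^ m"
    using mult_le_mono[OF Suc_leI[OF light] x] by (simp add: algebra_simps)
  also have "\<dots> < (2 * CARD('a) ^ k * CARD('a)) * CARD('a) ^ m"
    using q_ge_2 by simp
  also have "\<dots> = CARD('a ^ 'n) * 2" by (simp only: CARD_V Groups.mult_ac)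
  also have "\<dots> \<le> CARD('a ^ 'n) * c" using c by simp
  finally show ?thesis using c by simp
qed

lemma sum_line0:
  assumes "v \<noteq> 0" shows "sum F (line0 v) = - F v"
proof -
  have "inj_on (\<lambda>t. t *s v) (UNIV - {0})" using assms by (auto simp: inj_on_def)
  then have "sum F (line0 v) = (\<Sum>t\<in>UNIV - {0}. F (t *s v))" by (simp add: sum.reindex)
  also have "\<dots> = (\<Sum>t\<in>UNIV - {0 :: 'a}. F v)" by (intro sum.cong) (auto simp: F_scale)
  also have "\<dots> = of_nat (CARD('a) - 1) * F v" by (simp add: card_Diff_singleton)
  also have "of_nat (CARD('a) - 1) = (-1 :: 'a)"
    using q_ge_2 by (simp add: of_nat_diff of_nat_CARD_eq_0)
  finally show ?thesis by simp
qed

lemma sum_F_restrict: "sum F U = sum F (Z \<inter> U)"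
  by (rule sum.mono_neutral_right) auto

lemma card_line0: "v \<noteq> 0 \<Longrightarrow> card (line0 v) = CARD('a) - 1"
  by (rule fq.card_line_minus_0)

lemma line0_subset_Z: "F v \<noteq> 0 \<Longrightarrow> line0 v \<subseteq> Z"
  by (auto simp: F_scale)

lemma line0_disjoint:
  assumes ind: "\<And>t. z \<noteq> t *s r" shows "line0 r \<inter> line0 z = {}"
proof (rule ccontr)
  assume "\<not> ?thesis"
  then obtain s t where "s \<noteq> 0" "t \<noteq> 0" "s *s r = t *s z" by auto
  then have "z = (s / t) *s r"
    by (metis divide_inverse_commute left_inverse vector_smult_assoc vector_smult_lid)
  then show False using ind by blast
qed

section \<open>The values of the codeword\<close>

text \<open>The point \<open>r\<close> grows to \<open>P\<close> with \<open>q ^ m\<close> vectors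
  and no other point of the support. Averaging gives an extension \<open>S\<close> with at most one
  new point, and \<open>sum F S = - \<alpha>\<close> with \<open>F r \<noteq> \<alpha>\<close>
  forces one.\<close>

lemma two_point_subspace:
  assumes r: "F r \<noteq> 0" "F r \<noteq> \<alpha>"
  obtains S z where "fq.ksub S" "card S = CARD('a) ^ m * CARD('a)" "F z \<noteq> 0" "F r + F z = \<alpha>"
    "\<And>t. z \<noteq> t *s r" "Z \<inter> S = line0 r \<union> line0 z"
proof -
  have r0: "r \<noteq> 0" using r F_0 by auto
  have "\<exists>U'. fq.ksub U' \<and> fq.ext {0} r \<subseteq> U' \<and> card U' = CARD('a) ^ m \<and> Z \<inter> U' = Z \<inter> fq.ext {0} r"
  proof (rule fq.grow_avoiding_cone[OF fq_cone_Z _ _ m_pos])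
    show "fq.ksub (fq.ext {0} r)" by (rule fq.ksub_ext[OF fq.ksub_singleton_0])
    show "card (fq.ext {0} r) = CARD('a) ^ 1" using fq.card_ext[OF fq.ksub_singleton_0] r0 by simp
    fix j assume "j < m"
    then have "CARD('a) ^ j * CARD('a) \<le> CARD('a) ^ m" using q_ge_2 power_increasing[of "Suc j" m "CARD('a)"] by (simp add: Groups.mult_ac)
    then show "(card Z + 1) * CARD('a) ^ j < CARD('a ^ 'n)"
      using Z_subspace_product_small q_ge_2 by blast
  qed
  then obtain P where P: "fq.ksub P" "fq.ext {0} r \<subseteq> P" "card P = CARD('a) ^ m" "Z \<inter> P = Z \<inter> fq.ext {0} r"
    by blast
  have ZP: "Z \<inter> P = line0 r"
    unfolding P(4) using r by (auto simp: fq.ext_def F_scale F_0 image_iff)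
  have "\<exists>v. v \<notin> P \<and> card (Z \<inter> (fq.ext P v - P)) < 2 * (CARD('a) - 1)"
  proof (rule ccontr)
    assume "\<not> ?thesis"
    \<comment> \<open>Two new points in every extension would add up to at least
      \<open>2 * (q ^ (k + 1) - 1)\<close> vectors of the support, contradicting
      \<open>light\<close>.\<close>
    then have "2 * (CARD('a) - 1) * (CARD('a ^ 'n) - card P) \<le> card (Z - P) * (card P * (CARD('a) - 1))"
      by (intro fq.card_ge_if_extensions_rich[OF P(1)]) (meson not_le)
    then have "(CARD('a) - 1) * (2 * (CARD('a) ^ k * CARD('a) ^ m * CARD('a) - CARD('a) ^ m)) \<le> (CARD('a) - 1) * (card (Z - P) * CARD('a) ^ m)"
      unfolding P(3) CARD_V by (simp add: Groups.mult_ac)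
    then have "2 * (CARD('a) ^ k * CARD('a) ^ m * CARD('a) - CARD('a) ^ m) \<le> card (Z - P) * CARD('a) ^ m"
      using q_ge_2 by simp
    moreover have "2 * (CARD('a) ^ k * CARD('a) ^ m * CARD('a) - CARD('a) ^ m) = CARD('a) ^ m * (2 * (CARD('a) ^ k * CARD('a) - 1))"
      by (simp add: diff_mult_distrib2 Groups.mult_ac)
    ultimately have "2 * (CARD('a) ^ k * CARD('a) - 1) \<le> card (Z - P)"
      using q_ge_2 by (simp add: Groups.mult_ac)
    also have "\<dots> \<le> card Z" by (intro card_mono) auto
    finally have "2 * (CARD('a) ^ k * CARD('a) - 1) < 2 * CARD('a) ^ k * (CARD('a) - 1)" using light by simp
    moreover have "CARD('a) ^ k \<ge> 1" using q_ge_2 by simp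
    ultimately show False unfolding diff_mult_distrib2 mult.assoc by linarith
  qed
  then obtain v where v: "v \<notin> P" "card (Z \<inter> (fq.ext P v - P)) < 2 * (CARD('a) - 1)" by blast
  define S where "S = fq.ext P v"
  have S: "fq.ksub S" "card S = CARD('a) ^ m * CARD('a)" "P \<subseteq> S"
    using fq.ksub_ext[OF P(1)] fq.card_ext[OF P(1) v(1)] P(3) fq.subset_ext by (auto simp: S_def)
  have "sum F S = - \<alpha>"
    using S q_ge_2 by (intro sum_F fq_ksub_imp_fp_ksub) auto
  moreover have ZS: "Z \<inter> S = line0 r \<union> Z \<inter> (S - P)" using ZP S(3) by auto
  moreover have disj: "line0 r \<inter> (Z \<inter> (S - P)) = {}" using ZP by auto
  ultimately have sumS: "- F r + sum F (Z \<inter> (S - P)) = - \<alpha>"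
    using sum_F_restrict[of S] by (simp add: sum.union_disjoint sum_line0 r0)
  then have "Z \<inter> (S - P) \<noteq> {}" using r(2) by force
  then obtain z where z: "z \<in> Z \<inter> (S - P)" by blast
  have z0: "z \<noteq> 0" using z F_0 by auto
  have "line0 z \<subseteq> Z \<inter> (S - P)"
    using z line0_subset_Z fq.ksub_scale[OF S(1)] fq.ksub_scale_iff[OF P(1)] by auto
  moreover have "card (Z \<inter> (S - P)) = CARD('a) - 1"
  proof -
    have "CARD('a) - 1 dvd card (Z \<inter> (S - P))"
      by (intro fq.cone_card_dvd fq.cone_Int_Diff fq_cone_Z P(1) S(1))
    then obtain x where x: "card (Z \<inter> (S - P)) = (CARD('a) - 1) * x" by blast
    have "card (Z \<inter> (S - P)) > 0" using z by (auto simp: card_gt_0_iff)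
    moreover have "(CARD('a) - 1) * x < (CARD('a) - 1) * 2" using v(2) x by (simp add: S_def)
    then have "x < 2" using q_ge_2 mult_less_cancel1 by blast
    ultimately have "x = 1" using x by (cases x) auto
    then show ?thesis using x by simp
  qed
  ultimately have zline: "line0 z = Z \<inter> (S - P)"
    using card_line0[OF z0] by (intro card_subset_eq) auto
  show thesis
  proof
    show "fq.ksub S" "card S = CARD('a) ^ m * CARD('a)" "F z \<noteq> 0" using S z by auto
    show "F r + F z = \<alpha>" using sumS zline sum_line0[OF z0] by (simp add: algebra_simps)
    show "z \<noteq> t *s r" for t
    proof
      assume "z = t *s r"
      moreover have "r \<in> P" using P(2) fq.vec_in_ext[OF fq.ksub_singleton_0] by blast
      ultimately show False using z fq.ksub_scale[OF P(1)] by auto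
    qed
    show "Z \<inter> S = line0 r \<union> line0 z" using ZS zline by simp
  qed
qed

text \<open>Each \<open>(x, y) \<noteq> (0, 0)\<close> defines a hyperplane \<open>H\<close> of \<open>ext S v\<close>, the graph of
  \<open>s \<mapsto> x * s $ i + y * s $ j\<close>, that contains at most one of the two points of \<open>Z\<close> in \<open>S\<close>.
  Neither \<open>0\<close> nor the value of \<open>F\<close> at one of these points is \<open>\<alpha>\<close>, so \<open>H\<close> meets \<open>Z\<close> outside \<open>S\<close>.\<close>
lemma affine_part_large:
  assumes S: "fq.ksub S" "card S = CARD('a) ^ m * CARD('a)" and rz: "F r \<noteq> 0" "F z \<noteq> 0" "F r + F z = \<alpha>"
    and ind: "\<And>t. z \<noteq> t *s r" and ZS: "Z \<inter> S = line0 r \<union> line0 z" and v: "v \<notin> S"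
  shows "2 * (CARD('a) - 1) \<le> card {s \<in> S. F (s + v) \<noteq> 0}"
proof -
  have r0: "r \<noteq> 0" and z0: "z \<noteq> 0" using rz F_0 by auto
  obtain i j where ij: "r $ i * z $ j \<noteq> r $ j * z $ i" using independent_minor[OF r0 ind] .
  have disj: "line0 r \<inter> line0 z = {}" by (rule line0_disjoint[OF ind])
  show ?thesis
  proof (rule card_ge_if_affine_forms_cover[of _ "\<lambda>s. s $ i" "\<lambda>s. s $ j"])
    fix x y :: 'a assume xy: "(x, y) \<noteq> (0, 0)"
    define lam where "lam s = x * s $ i + y * s $ j" for s :: "'a ^ 'n"
    have lam_add: "lam (s + s') = lam s + lam s'" for s s' by (simp add: lam_def algebra_simps)
    have lam_scale: "lam (t *s s) = t * lam s" for s t by (simp add: lam_def algebra_simps)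
    define H where "H = (\<lambda>s. s + lam s *s v) ` S"
    have inj: "inj_on (\<lambda>s. s + lam s *s v) S"
      using fq.ext_coords_unique[OF S(1) v] by (auto simp: inj_on_def)
    have H: "fp.ksub H"
    proof (rule fq_ksub_imp_fp_ksub, unfold fq.ksub_def, intro conjI ballI)
      show "0 \<in> H" unfolding H_def using fq.ksub_zero[OF S(1)] by (force simp: lam_def)
    next
      fix a b assume "a \<in> H" "b \<in> H"
      then obtain s s' where s: "s \<in> S" "s' \<in> S" "a = s + lam s *s v" "b = s' + lam s' *s v"
        unfolding H_def by blast
      then have "a + b = (s + s') + lam (s + s') *s v"
        by (simp add: lam_add vector_sadd_rdistrib)
      then show "a + b \<in> H" unfolding H_def using fq.ksub_add[OF S(1)] s by blast
    next
      fix t a assume "a \<in> H"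
      then obtain s where s: "s \<in> S" "a = s + lam s *s v" unfolding H_def by blast
      then have "t *s a = t *s s + lam (t *s s) *s v"
        by (simp add: lam_scale vector_add_ldistrib)
      then show "t *s a \<in> H" unfolding H_def using fq.ksub_scale[OF S(1)] s by blast
    qed
    have "card H = card S" unfolding H_def using inj by (rule card_image)
    then have sumH: "sum F H = - \<alpha>" using H S(2) q_ge_2 by (intro sum_F) auto
    show "\<exists>s\<in>{s \<in> S. F (s + v) \<noteq> 0}. x * s $ i + y * s $ j = 1"
    proof (rule ccontr)
      assume none: "\<not> ?thesis"
      \<comment> \<open>A vector of \<open>H\<close> outside \<open>S\<close> can be rescaled to
        \<open>s' + v\<close> with \<open>lam s' = 1\<close>, and such vectors are outside the
        support by \<open>none\<close>.\<close>
      have off: "F (s + lam s *s v) = 0" if s: "s \<in> S" "lam s \<noteq> 0" for s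
      proof -
        have "lam (inverse (lam s) *s s) = 1" using s by (simp add: lam_scale)
        moreover have "inverse (lam s) *s s \<in> S" using fq.ksub_scale[OF S(1)] s by blast
        ultimately have "F (inverse (lam s) *s s + v) = 0"
          using none unfolding lam_def by blast
        moreover have "s + lam s *s v = lam s *s (inverse (lam s) *s s + v)"
          using s by (simp add: vector_add_ldistrib)
        ultimately show ?thesis using F_scale s by metis
      qed
      \<comment> \<open>The nonzero minor prevents \<open>H\<close> from containing both
        \<open>r\<close> and \<open>z\<close>.\<close>
      have lam0: "lam r \<noteq> 0 \<or> lam z \<noteq> 0"
      proof (rule ccontr)
        assume "\<not> ?thesis"
        then have e: "x * r $ i + y * r $ j = 0" "x * z $ i + y * z $ j = 0" by (auto simp: lam_def)
        have "x * (r $ i * z $ j - r $ j * z $ i)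
          = (x * r $ i + y * r $ j) * z $ j - (x * z $ i + y * z $ j) * r $ j"
          by (simp add: algebra_simps)
        also have "\<dots> = 0" using e by simp
        finally have "x = 0" using ij by simp
        moreover have "y * (r $ i * z $ j - r $ j * z $ i)
          = (x * z $ i + y * z $ j) * r $ i - (x * r $ i + y * r $ j) * z $ i"
          by (simp add: algebra_simps)
        then have "y * (r $ i * z $ j - r $ j * z $ i) = 0" using e by simp
        then have "y = 0" using ij by simp
        ultimately show False using xy by simp
      qed
      have "sum F H = (\<Sum>s\<in>S. F (s + lam s *s v))"
        unfolding H_def using inj by (simp add: sum.reindex)
      also have "\<dots> = (\<Sum>s\<in>S. if lam s = 0 then F s else 0)"
        using off by (intro sum.cong) auto
      also have "\<dots> = (\<Sum>s\<in>Z \<inter> S. if lam s = 0 then F s else 0)"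
        by (rule sum.mono_neutral_right) auto
      also have "\<dots> = (\<Sum>s\<in>line0 r. if lam s = 0 then F s else 0) + (\<Sum>s\<in>line0 z. if lam s = 0 then F s else 0)"
        unfolding ZS using disj by (intro sum.union_disjoint) auto
      also have "(\<Sum>s\<in>line0 r. if lam s = 0 then F s else 0) = (if lam r = 0 then sum F (line0 r) else 0)"
        by (cases "lam r = 0") (auto intro!: sum.cong sum.neutral simp: lam_scale F_0 split: if_splits)
      also have "(\<Sum>s\<in>line0 z. if lam s = 0 then F s else 0) = (if lam z = 0 then sum F (line0 z) else 0)"
        by (cases "lam z = 0") (auto intro!: sum.cong sum.neutral simp: lam_scale F_0 split: if_splits)
      finally have "(if lam r = 0 then - F r else 0) + (if lam z = 0 then - F z else 0) = - \<alpha>"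
        using sumH sum_line0[OF r0] sum_line0[OF z0] by simp
      then show False using lam0 rz \<alpha>_nz by (auto split: if_splits)
    qed
  qed simp
qed

text \<open>By \<open>affine_part_large\<close> every extension of the two-point subspace
  \<open>S\<close> gains \<open>2 * (q - 1)\<close> points. Averaging these and adding the two
  points inside \<open>S\<close> reaches exactly the bound excluded by \<open>light\<close>.\<close>

lemma F_values: "F r = 0 \<or> F r = \<alpha>"
proof (rule ccontr)
  assume "\<not> ?thesis"
  then have r: "F r \<noteq> 0" "F r \<noteq> \<alpha>" by auto
  obtain S z where S: "fq.ksub S" "card S = CARD('a) ^ m * CARD('a)" and z: "F z \<noteq> 0" "F r + F z = \<alpha>"
    and ind: "\<And>t. z \<noteq> t *s r" and ZS: "Z \<inter> S = line0 r \<union> line0 z"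
    using two_point_subspace[OF r] by metis
  have r0: "r \<noteq> 0" and z0: "z \<noteq> 0" using r z F_0 by auto
  have "2 * (CARD('a) - 1) * (CARD('a) - 1) \<le> card (Z \<inter> (fq.ext S v - S))" if v: "v \<notin> S" for v
  proof -
    define A where "A = {s \<in> S. F (s + v) \<noteq> 0}"
    have eq: "t *s (s + v) = t *s s + t *s v" for t s by (simp add: vector_add_ldistrib)
    \<comment> \<open>Each affine vector \<open>s + v\<close> in the support contributes its
      \<open>q - 1\<close> nonzero multiples, all distinct.\<close>
    have "card ((UNIV - {0 :: 'a}) \<times> A) \<le> card (Z \<inter> (fq.ext S v - S))"
    proof (rule card_inj_on_le[of "\<lambda>(t, s). t *s (s + v)"])
      show "inj_on (\<lambda>(t, s). t *s (s + v)) ((UNIV - {0}) \<times> A)"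
      proof (rule inj_onI, unfold split_paired_all split_conv)
        fix t t' :: 'a and s s' assume *: "(t, s) \<in> (UNIV - {0}) \<times> A" "(t', s') \<in> (UNIV - {0}) \<times> A"
          "t *s (s + v) = t' *s (s' + v)"
        then have "t *s s = t' *s s' \<and> t = t'"
          using fq.ext_coords_unique[OF S(1) v, of "t *s s" "t' *s s'" t t'] fq.ksub_scale[OF S(1)]
          by (auto simp: eq A_def)
        then show "(t, s) = (t', s')" using * by auto
      qed
      show "(\<lambda>(t, s). t *s (s + v)) ` ((UNIV - {0}) \<times> A) \<subseteq> Z \<inter> (fq.ext S v - S)"
      proof (rule image_subsetI, unfold split_paired_all split_conv)
        fix t :: 'a and s assume "(t, s) \<in> (UNIV - {0}) \<times> A"
        then have *: "t \<noteq> 0" "s \<in> A" by auto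
        have "t *s (s + v) \<in> fq.ext S v"
          unfolding eq using * fq.ksub_scale[OF S(1)] by (auto simp: A_def intro!: fq.extI)
        moreover have "t *s (s + v) \<notin> S"
        proof
          assume "t *s (s + v) \<in> S"
          then have "s + v \<in> S" using fq.ksub_scale_iff[OF S(1) UNIV_I *(1)] by blast
          then have "s + v - s \<in> S" using * by (intro fq.ksub_diff[OF S(1)]) (auto simp: A_def)
          then show False using v by simp
        qed
        ultimately show "t *s (s + v) \<in> Z \<inter> (fq.ext S v - S)"
          using *(2) F_scale[OF *(1), of "s + v"] by (auto simp: A_def)
      qed
    qed auto
    moreover have "2 * (CARD('a) - 1) \<le> card A"
      unfolding A_def by (rule affine_part_large[OF S r(1) z ind ZS v])
    then have "2 * (CARD('a) - 1) * (CARD('a) - 1) \<le> card A * (CARD('a) - 1)" by (rule mult_le_mono1)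
    moreover have "card ((UNIV - {0 :: 'a}) \<times> A) = card A * (CARD('a) - 1)"
      by (simp add: card_cartesian_product card_Diff_singleton)
    ultimately show ?thesis by linarith
  qed
  then have "2 * (CARD('a) - 1) * (CARD('a) - 1) * (CARD('a ^ 'n) - card S) \<le> card (Z - S) * (card S * (CARD('a) - 1))"
    by (rule fq.card_ge_if_extensions_rich[OF S(1)])
  then have "(CARD('a) - 1) * (2 * (CARD('a) - 1) * (CARD('a) ^ k * CARD('a) ^ m * CARD('a) - CARD('a) ^ m * CARD('a))) \<le> (CARD('a) - 1) * (card (Z - S) * (CARD('a) ^ m * CARD('a)))"
    unfolding S(2) CARD_V by (simp add: Groups.mult_ac)
  then have "2 * (CARD('a) - 1) * (CARD('a) ^ k * CARD('a) ^ m * CARD('a) - CARD('a) ^ m * CARD('a)) \<le> card (Z - S) * (CARD('a) ^ m * CARD('a))"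
    using q_ge_2 by simp
  moreover have "CARD('a) ^ k * CARD('a) ^ m * CARD('a) - CARD('a) ^ m * CARD('a)
      = (CARD('a) ^ k - 1) * (CARD('a) ^ m * CARD('a))"
    by (simp only: diff_mult_distrib mult.assoc mult_1_left)
  ultimately have "(2 * (CARD('a) - 1) * (CARD('a) ^ k - 1)) * (CARD('a) ^ m * CARD('a)) \<le> card (Z - S) * (CARD('a) ^ m * CARD('a))"
    by (simp only: mult.assoc)
  then have "2 * (CARD('a) - 1) * (CARD('a) ^ k - 1) \<le> card (Z - S)"
    using q_ge_2 by (subst (asm) mult_le_cancel2) simp
  moreover have "card (Z \<inter> S) = 2 * (CARD('a) - 1)"
  proof -
    have "line0 r \<inter> line0 z = {}" by (rule line0_disjoint[OF ind])
    then show ?thesis unfolding ZS by (simp add: card_Un_disjoint card_line0 r0 z0)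
  qed
  moreover have "card Z = card (Z - S) + card (Z \<inter> S)"
    by (subst card_Un_disjoint[symmetric]) (auto intro: arg_cong[where f = card])
  ultimately have "2 * (CARD('a) - 1) * (CARD('a) ^ k - 1) + 2 * (CARD('a) - 1) \<le> card Z" by simp
  moreover have "2 * (CARD('a) - 1) * (CARD('a) ^ k - 1) + 2 * (CARD('a) - 1) = 2 * CARD('a) ^ k * (CARD('a) - 1)"
  proof -
    have "2 * (CARD('a) - 1) * (CARD('a) ^ k - 1) + 2 * (CARD('a) - 1) = 2 * (CARD('a) - 1) * ((CARD('a) ^ k - 1) + 1)"
      by (simp only: distrib_left mult_1_right)
    also have "(CARD('a) ^ k - 1) + 1 = CARD('a) ^ k" using q_ge_2 by simp
    finally show ?thesis by (simp add: Groups.mult_ac)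
  qed
  ultimately show False using light by simp
qed

subsection \<open>Lines over the prime field\<close>

lemma fp_cone_Z: "fp.cone Z"
  by (auto simp: fp.cone_def F_0 F_scale)

text \<open>All nonzero values equal \<alpha>, so the sum over \<open>U\<close> is a count times
  \<alpha>. As a point over F_p has \<open>p - 1\<close> vectors, the number of points is 1 modulo
  \<open>p\<close>.\<close>

lemma CHAR_dvd_card_Z_Int:
  assumes "fp.ksub U" "CARD('a) ^ m < card U" shows "CHAR('a) dvd card (Z \<inter> U) + 1"
proof -
  have "- \<alpha> = sum F (Z \<inter> U)" using sum_F[OF assms] sum_F_restrict by simp
  also have "\<dots> = (\<Sum>v\<in>Z \<inter> U. \<alpha>)" using F_values by (intro sum.cong) auto
  finally have "of_nat (card (Z \<inter> U)) * \<alpha> = - \<alpha>" by simp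
  then have "of_nat (card (Z \<inter> U) + 1) * \<alpha> = 0" by (simp add: distrib_right)
  then have "of_nat (card (Z \<inter> U) + 1) = (0 :: 'a)" using \<alpha>_nz by (simp del: of_nat_add of_nat_Suc)
  then show ?thesis using of_nat_eq_0_iff_char_dvd by blast
qed

text \<open>\<open>L\<close> grows over F_p to \<open>q ^ m\<close> vectors without new points of
  the support; one more extension makes the congruence apply. If each of these gained three points,
  \<open>card Z\<close> would be at least \<open>3 * (q ^ (k + 1) - 1)\<close>, contradicting
  \<open>light\<close>.\<close>

lemma poor_extension:
  assumes L: "fp.ksub L" "card L = CHAR('a) ^ 2" and le: "CHAR('a) ^ 2 \<le> CARD('a) ^ m"
  obtains U v where "fp.ksub U" "L \<subseteq> U" "Z \<inter> U = Z \<inter> L" "card U = CARD('a) ^ m" "v \<notin> U"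
    "card (Z \<inter> (fp.ext U v - U)) < 3 * (CHAR('a) - 1)"
proof -
  obtain h where h: "CARD('a) = CHAR('a) ^ h" using CARD_eq_CHAR_power by blast
  then have qm: "CARD('a) ^ m = CHAR('a) ^ (h * m)" by (simp add: power_mult)
  have "2 \<le> h * m" using le char_ge_5 unfolding qm by (subst (asm) power_increasing_iff) auto
  then have "\<exists>U. fp.ksub U \<and> L \<subseteq> U \<and> card U = CHAR('a) ^ (h * m) \<and> Z \<inter> U = Z \<inter> L"
  proof (rule fp.grow_avoiding_cone[OF fp_cone_Z L(1), unfolded card_range_of_int, OF L(2)])
    fix j assume "j < h * m"
    then have "CHAR('a) ^ j * CHAR('a) \<le> CARD('a) ^ m"
      using char_ge_5 power_increasing[of "Suc j" "h * m" "CHAR('a)"] by (simp add: qm Groups.mult_ac)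
    then show "(card Z + 1) * CHAR('a) ^ j < CARD('a ^ 'n)"
      using char_ge_5 by (intro Z_subspace_product_small) auto
  qed
  then obtain U where U: "fp.ksub U" "L \<subseteq> U" "card U = CARD('a) ^ m" "Z \<inter> U = Z \<inter> L"
    unfolding qm by blast
  have "\<exists>v. v \<notin> U \<and> card (Z \<inter> (fp.ext U v - U)) < 3 * (CHAR('a) - 1)"
  proof (rule ccontr)
    assume "\<not> ?thesis"
    then have "3 * (CHAR('a) - 1) * (CARD('a ^ 'n) - card U) \<le> card (Z - U) * (card U * (CHAR('a) - 1))"
      by (intro fp.card_ge_if_extensions_rich[OF U(1), unfolded card_range_of_int]) (meson not_le)
    then have "(CHAR('a) - 1) * (3 * (CARD('a) ^ k * CARD('a) ^ m * CARD('a) - CARD('a) ^ m))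
        \<le> (CHAR('a) - 1) * (card (Z - U) * CARD('a) ^ m)"
      unfolding U(3) CARD_V by (simp add: Groups.mult_ac)
    then have "3 * (CARD('a) ^ k * CARD('a) ^ m * CARD('a) - CARD('a) ^ m) \<le> card (Z - U) * CARD('a) ^ m"
      using char_ge_5 by simp
    moreover have "3 * (CARD('a) ^ k * CARD('a) ^ m * CARD('a) - CARD('a) ^ m)
        = CARD('a) ^ m * (3 * (CARD('a) ^ k * CARD('a) - 1))"
      by (simp add: diff_mult_distrib2 Groups.mult_ac)
    ultimately have "3 * (CARD('a) ^ k * CARD('a) - 1) \<le> card (Z - U)"
      using q_ge_2 by (simp add: Groups.mult_ac)
    also have "\<dots> \<le> card Z" by (intro card_mono) auto
    finally have "3 * (CARD('a) ^ k * CARD('a) - 1) < 2 * CARD('a) ^ k * (CARD('a) - 1)" using light by simp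
    moreover have "CARD('a) ^ k \<ge> 1" "CARD('a) ^ k * CARD('a) \<ge> 1" using q_ge_2 by simp_all
    ultimately show False unfolding diff_mult_distrib2 mult.assoc by linarith
  qed
  then show thesis using that U by blast
qed

text \<open>In terms of the points over the prime field: \<open>x\<close> of them lie on the line \<open>L\<close> and \<open>y\<close> more in an
  extension by a poor vector, and \<open>x + y \<equiv> 1\<close> modulo \<open>p\<close>.\<close>
lemma line_point_count:
  assumes L: "fp.ksub L" "card L = CHAR('a) ^ 2" and many: "CHAR('a) - 1 < card (Z \<inter> L)"
  obtains x where "card (Z \<inter> L) = x * (CHAR('a) - 1)" "CHAR('a) + 1 \<le> x"
  | x y U v where "card (Z \<inter> L) = x * (CHAR('a) - 1)" "fp.ksub U" "L \<subseteq> U" "v \<notin> U"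
    "card (Z \<inter> (fp.ext U v - U)) = y * (CHAR('a) - 1)" "y < 3" "CHAR('a) + 1 \<le> x + y"
proof -
  have "fp.cone (Z \<inter> L)" using fp_cone_Z L(1) by (auto simp: fp.cone_def fp.ksub_scale)
  then have "CHAR('a) - 1 dvd card (Z \<inter> L)" using fp.cone_card_dvd card_range_of_int by metis
  then obtain x where x: "card (Z \<inter> L) = x * (CHAR('a) - 1)" by (metis dvd_def mult.commute)
  have "x \<ge> 2"
  proof (rule ccontr)
    assume "\<not> x \<ge> 2"
    then have "x = 0 \<or> x = 1" by linarith
    then show False using many x by auto
  qed
  show thesis
  proof (cases "CHAR('a) ^ 2 \<le> CARD('a) ^ m")
    case False
    \<comment> \<open>The line alone has more than \<open>q ^ m\<close> vectors, so the congruence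
      applies to it directly.\<close>
    then have "CHAR('a) dvd x * (CHAR('a) - 1) + 1"
      using CHAR_dvd_card_Z_Int[OF L(1)] L(2) x by simp
    then have "CHAR('a) + 1 \<le> x"
      using \<open>x \<ge> 2\<close> char_ge_5 by (intro large_if_dvd_mult_pred) auto
    then show thesis using that(1) x by blast
  next
    case True
    obtain U v where U: "fp.ksub U" "L \<subseteq> U" "Z \<inter> U = Z \<inter> L" "card U = CARD('a) ^ m" "v \<notin> U"
      and few: "card (Z \<inter> (fp.ext U v - U)) < 3 * (CHAR('a) - 1)"
      using poor_extension[OF L True] .
    have "CHAR('a) - 1 dvd card (Z \<inter> (fp.ext U v - U))"
      using fp.cone_card_dvd[OF fp.cone_Int_Diff[OF fp_cone_Z U(1) fp.ksub_ext[OF U(1)]]] card_range_of_int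
      by metis
    then obtain y where y: "card (Z \<inter> (fp.ext U v - U)) = y * (CHAR('a) - 1)" by (metis dvd_def mult.commute)
    have "y < 3" using few char_ge_5 unfolding y by (subst (asm) mult_less_cancel2) simp
    have "Z \<inter> fp.ext U v = Z \<inter> L \<union> Z \<inter> (fp.ext U v - U)"
      using U(3) fp.subset_ext[of U v] by blast
    moreover have "Z \<inter> L \<inter> (Z \<inter> (fp.ext U v - U)) = {}" using U(2) by blast
    ultimately have "card (Z \<inter> fp.ext U v) = (x + y) * (CHAR('a) - 1)"
      using x y by (simp add: card_Un_disjoint distrib_right)
    moreover have "CARD('a) ^ m < card (fp.ext U v)"
      using fp.card_ext[OF U(1,5)] U(4) card_range_of_int[where 'a='a] char_ge_5 q_ge_2 by simp
    ultimately have "CHAR('a) dvd (x + y) * (CHAR('a) - 1) + 1"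
      using CHAR_dvd_card_Z_Int[OF fp.ksub_ext[OF U(1)]] by metis
    then have "CHAR('a) + 1 \<le> x + y"
      using \<open>x \<ge> 2\<close> char_ge_5 by (intro large_if_dvd_mult_pred) auto
    then show thesis using that(2) x y U \<open>y < 3\<close> by blast
  qed
qed

text \<open>For \<open>b\<close> outside the span of \<open>a\<close> this is a projective line over
  F_p: \<open>p ^ 2\<close> vectors and \<open>p + 1\<close> points.\<close>

abbreviation fp_line :: "'a ^ 'n \<Rightarrow> 'a ^ 'n \<Rightarrow> ('a ^ 'n) set" where
  "fp_line a b \<equiv> fp.ext (fp.ext {0} a) b"

lemma fp_point_Z:
  assumes "F a \<noteq> 0" shows "fp.ext {0} a - {0} \<subseteq> Z" "card (fp.ext {0} a - {0}) = CHAR('a) - 1"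
proof -
  have a0: "a \<noteq> 0" using assms F_0 by auto
  show "fp.ext {0} a - {0} \<subseteq> Z" using assms by (auto simp: fp.ext_def F_scale)
  have "0 \<in> fp.ext {0} a" using fp.subset_ext by blast
  then show "card (fp.ext {0} a - {0}) = CHAR('a) - 1"
    using fp.card_ext[OF fp.ksub_singleton_0, of a] a0 card_range_of_int[where 'a='a]
    by (simp add: card_Diff_singleton)
qed

lemma fp_line:
  assumes ab: "F a \<noteq> 0" "F b \<noteq> 0" "b \<notin> fp.ext {0} a"
  shows "fp.ksub (fp_line a b)" "card (fp_line a b) = CHAR('a) ^ 2"
    "CHAR('a) - 1 < card (Z \<inter> fp_line a b)"
proof -
  have a: "fp.ksub (fp.ext {0} a)" by (rule fp.ksub_ext[OF fp.ksub_singleton_0])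
  then show L: "fp.ksub (fp_line a b)" by (rule fp.ksub_ext)
  have "a \<noteq> 0" using ab F_0 by auto
  then have "card (fp.ext {0} a) = CHAR('a)"
    using fp.card_ext[OF fp.ksub_singleton_0, of a] card_range_of_int[where 'a='a] by simp
  then show "card (fp_line a b) = CHAR('a) ^ 2"
    using fp.card_ext[OF a ab(3)] card_range_of_int[where 'a='a] by (simp add: power2_eq_square)
  have "fp.ext {0} a - {0} \<subset> Z \<inter> fp_line a b"
    using fp_point_Z(1)[OF ab(1)] fp.subset_ext[of "fp.ext {0} a" b] fp.vec_in_ext[OF a, of b] ab by blast
  then have "card (fp.ext {0} a - {0}) < card (Z \<inter> fp_line a b)" by (intro psubset_card_mono) auto
  then show "CHAR('a) - 1 < card (Z \<inter> fp_line a b)" using fp_point_Z(2)[OF ab(1)] by simp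
qed

text \<open>From \<open>p + 1 \<le> x + y\<close> and \<open>y \<le> 2\<close>, the line has at
  least \<open>p - 1\<close> points of the support.\<close>

lemma line_rich:
  assumes ab: "F a \<noteq> 0" "F b \<noteq> 0" "b \<notin> fp.ext {0} a"
  shows "(CHAR('a) - 1) * (CHAR('a) - 1) \<le> card (Z \<inter> fp_line a b)"
  using fp_line[OF ab]
proof (cases rule: line_point_count)
  case (1 x)
  then have "CHAR('a) - 1 \<le> x" by linarith
  then show ?thesis unfolding 1(1) by (rule mult_le_mono1)
next
  case (2 x y U v)
  then have "CHAR('a) - 1 \<le> x" by linarith
  then show ?thesis unfolding 2(1) by (rule mult_le_mono1)
qed

text \<open>A further point \<open>T\<close> of \<open>Z\<close> in the poor extension would span with \<open>a\<close> a line that carries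
  too many points of \<open>Z\<close>.\<close>
lemma line_full:
  assumes ab: "F a \<noteq> 0" "F b \<noteq> 0" "b \<notin> fp.ext {0} a"
  shows "fp_line a b - {0} \<subseteq> Z"
proof -
  have "(CHAR('a) + 1) * (CHAR('a) - 1) \<le> card (Z \<inter> fp_line a b)"
    using fp_line[OF ab]
  proof (cases rule: line_point_count)
    case (1 x)
    show ?thesis unfolding 1(1) using 1(2) by (rule mult_le_mono1)
  next
    case (2 x y U v)
    let ?W = "fp.ext U v"
    have "y = 0"
    proof (rule ccontr)
      assume "y \<noteq> 0"
      then have "card (Z \<inter> (?W - U)) \<noteq> 0" using 2(5) char_ge_5 by simp
      then obtain T where T: "T \<in> Z \<inter> (?W - U)" by (metis card.empty ex_in_conv)
      have a_sub: "fp.ext {0} a \<subseteq> U" using 2(3) fp.subset_ext by blast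
      have W: "fp.ksub ?W" "U \<subseteq> ?W" using fp.ksub_ext[OF 2(2)] fp.subset_ext by auto
      have line: "(CHAR('a) - 1) * (CHAR('a) - 1) \<le> card (Z \<inter> fp_line a T)"
        using T a_sub by (intro line_rich ab(1)) auto
      have "fp_line a T \<subseteq> ?W"
        using T a_sub W by (intro fp.ext_subset[OF W(1), of "fp.ext {0} a"]) auto
      moreover have "fp_line a T \<inter> U \<subseteq> fp.ext {0} a"
      proof
        fix w assume w: "w \<in> fp_line a T \<inter> U"
        then obtain u t where ut: "u \<in> fp.ext {0} a" "t \<in> range of_int" "w = u + t *s T"
          by (meson IntD1 fp.extE)
        have "t *s T = w - u" using ut by simp
        also have "\<dots> \<in> U" using fp.ksub_diff[OF 2(2)] w ut(1) a_sub by blast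
        finally have "t = 0" using fp.ksub_scale_iff[OF 2(2) ut(2)] T by blast
        then show "w \<in> fp.ext {0} a" using ut by simp
      qed
      ultimately have "Z \<inter> fp_line a T \<subseteq> (Z \<inter> (?W - U)) \<union> (fp.ext {0} a - {0})"
        using F_0 by blast
      then have "card (Z \<inter> fp_line a T) \<le> card ((Z \<inter> (?W - U)) \<union> (fp.ext {0} a - {0}))"
        by (intro card_mono) auto
      also have "\<dots> \<le> y * (CHAR('a) - 1) + (CHAR('a) - 1)"
        using card_Un_le[of "Z \<inter> (?W - U)" "fp.ext {0} a - {0}"] 2(5) fp_point_Z(2)[OF ab(1)] by simp
      also have "\<dots> = (y + 1) * (CHAR('a) - 1)" by simp
      finally have "(CHAR('a) - 1) * (CHAR('a) - 1) \<le> (y + 1) * (CHAR('a) - 1)" using line by linarith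
      then have "CHAR('a) - 1 \<le> y + 1" using char_ge_5 by (subst (asm) mult_le_cancel2) simp
      \<comment> \<open>The line through \<open>a\<close> and \<open>T\<close> meets
        \<open>U\<close> only in the point \<open>a\<close>, so it has at most
        \<open>y + 1 \<le> 3\<close> points of the support, but
        \<open>p - 1 \<ge> 4\<close>.\<close>
      then show False using 2(6) char_ge_5 by simp
    qed
    then have "CHAR('a) + 1 \<le> x" using 2(7) by simp
    then show ?thesis unfolding 2(1) by (rule mult_le_mono1)
  qed
  also have "(CHAR('a) + 1) * (CHAR('a) - 1) = card (fp_line a b - {0})"
  proof -
    have "0 \<in> fp_line a b" using fp.ksub_zero[OF fp_line(1)[OF ab]] .
    then show ?thesis using fp_line(2)[OF ab]
      by (simp add: card_Diff_singleton power2_eq_square diff_mult_distrib2)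
  qed
  finally have "Z \<inter> fp_line a b = fp_line a b - {0}"
    using F_0 by (intro card_seteq) auto
  then show ?thesis by blast
qed

section \<open>The support as a subspace\<close>

text \<open>Full lines over F_p give closure under addition; closure under all scalars of the field
  is \<open>F_scale\<close>.\<close>

lemma fq_ksub_Z: "fq.ksub (insert 0 Z)"
  unfolding fq.ksub_def
proof (intro conjI ballI)
  fix a b assume ab: "a \<in> insert 0 Z" "b \<in> insert 0 Z"
  show "a + b \<in> insert 0 Z"
  proof (cases "a = 0 \<or> b = 0")
    case True
    then show ?thesis using ab by auto
  next
    case False
    then have F: "F a \<noteq> 0" "F b \<noteq> 0" using ab by auto
    have a: "fp.ksub (fp.ext {0} a)" "a \<in> fp.ext {0} a"
      using fp.ksub_ext fp.vec_in_ext fp.ksub_singleton_0 by blast+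
    show ?thesis
    proof (cases "b \<in> fp.ext {0} a")
      case True
      then have "a + b \<in> fp.ext {0} a" using fp.ksub_add a by blast
      then show ?thesis using fp_point_Z(1)[OF F(1)] by blast
    next
      case b: False
      have "a \<in> fp_line a b" "b \<in> fp_line a b"
        using fp.subset_ext fp.vec_in_ext a by blast+
      then have "a + b \<in> fp_line a b" using fp.ksub_add fp_line(1)[OF F b] by blast
      then show ?thesis using line_full[OF F b] by blast
    qed
  qed
next
  fix t a assume "a \<in> insert 0 Z"
  then show "t *s a \<in> insert 0 Z" by (cases "t = 0") (auto simp: F_scale)
qed simp

text \<open>A subspace has \<open>q ^ j\<close> vectors, and
  \<open>2 * q ^ k * (q - 1) < q ^ (k + 2)\<close> excludes \<open>j \<ge> k + 2\<close>.\<close>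

theorem card_Z_le: "card Z \<le> CARD('a) ^ (k + 1) - 1"
proof -
  obtain j where j: "card (insert 0 Z) = CARD('a) ^ j" using fq.ksub_card_power[OF fq_ksub_Z] by blast
  then have Z: "card Z + 1 = CARD('a) ^ j" using F_0 by simp
  then have "CARD('a) ^ j \<le> 2 * CARD('a) ^ k * (CARD('a) - 1)" using light by linarith
  also have "\<dots> < CARD('a) * CARD('a) ^ k * CARD('a)" using q_ge_2 by (intro mult_le_less_imp_less) auto
  also have "\<dots> = CARD('a) ^ (k + 2)" by simp
  finally have "j < k + 2" using q_ge_2 by (subst (asm) power_strict_increasing_iff) auto
  then have "CARD('a) ^ j \<le> CARD('a) ^ (k + 1)" using q_ge_2 by (intro power_increasing) auto
  then show ?thesis using Z by linarith
qed

end

section \<open>Projective points and the code\<close>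

lemma fq_ksub_iff_subspace: "fq.ksub U \<longleftrightarrow> vec.subspace U"
  by (auto simp: fq.ksub_def vec.subspace_def)

lemma card_vec_subspace:
  fixes W :: "('a::{field,finite} ^ 'n) set"
  assumes W: "vec.subspace W" shows "card W = CARD('a) ^ vec.dim W"
proof -
  obtain B where B: "B \<subseteq> W" "vec.independent B" "W \<subseteq> vec.span B" "card B = vec.dim W"
    by (rule vec.basis_exists)
  have "finite B" by simp
  then have "card (vec.span B) = CARD('a) ^ card B" using B(2)
  proof (induction B rule: finite_induct)
    case empty
    then show ?case by simp
  next
    case (insert b B)
    have sub: "fq.ksub (vec.span B)" by (simp add: fq_ksub_iff_subspace)
    have "vec.span (insert b B) = fq.ext (vec.span B) b"
    proof (intro equalityI subsetI)
      fix x assume "x \<in> vec.span (insert b B)"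
      then obtain t where "x - t *s b \<in> vec.span B" by (auto simp: vec.span_insert)
      then show "x \<in> fq.ext (vec.span B) b" using fq.extI[of "x - t *s b" "vec.span B" t b] by simp
    next
      fix x assume "x \<in> fq.ext (vec.span B) b"
      then obtain u t where "u \<in> vec.span B" "x = u + t *s b" by (rule fq.extE)
      then show "x \<in> vec.span (insert b B)" by (auto simp: vec.span_insert intro!: exI[of _ t])
    qed
    moreover have "b \<notin> vec.span B" "vec.independent B"
      using insert by (auto simp: vec.independent_insert)
    ultimately show ?case using insert fq.card_ext[OF sub] by simp
  qed
  moreover have "vec.span B = W" using B W by (simp add: vec.span_minimal subset_antisym)
  ultimately show ?thesis using B by simp
qed

lemma card_proj_subspace:
  "W \<in> proj_subspaces j \<Longrightarrow> card W = CARD('a) ^ (j + 1)" for W :: "('a::{field,finite} ^ 'n) set"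
  by (simp add: proj_subspaces_def card_vec_subspace del: power_Suc)

lemma span_in_proj_points_iff: "vec.span {v} \<in> proj_points \<longleftrightarrow> v \<noteq> 0"
proof (cases "v = 0")
  case True
  then show ?thesis by (simp add: proj_points_def proj_subspaces_def)
next
  case False
  then have "vec.dim {v} = 1"
    using vec.dim_eq_card_independent[of "{v}"] by (simp add: vec.independent_insert)
  then show ?thesis using False by (simp add: proj_points_def proj_subspaces_def)
qed

lemma span_eq_proj_point_iff:
  assumes P: "P \<in> proj_points" shows "vec.span {v} = P \<longleftrightarrow> v \<in> P - {0}"
proof
  assume "vec.span {v} = P"
  then show "v \<in> P - {0}" using P span_in_proj_points_iff[of v] vec.span_base[of v "{v}"] by auto
next
  assume v: "v \<in> P - {0}"
  have "vec.subspace P" "vec.dim P = 1" using P by (auto simp: proj_points_def proj_subspaces_def)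
  moreover have "vec.dim {v} = 1"
    using v span_in_proj_points_iff[of v] by (auto simp: proj_points_def proj_subspaces_def)
  ultimately show "vec.span {v} = P"
    using v vec.subspace_dim_equal[of "vec.span {v}" P] vec.span_minimal[of "{v}" P] by auto
qed

text \<open>Grouping by span meets each point \<open>q - 1\<close> times. Over the naturals this
  converts weights into vector counts, over the field scalar products into vector sums.\<close>

lemma sum_vectors_eq_sum_points:
  fixes W :: "('a::{field,finite} ^ 'n) set" and g :: "_ \<Rightarrow> 'b::semiring_1"
  assumes W: "vec.subspace W"
  shows "(\<Sum>v\<in>W - {0}. g (vec.span {v})) = of_nat (CARD('a) - 1) * (\<Sum>P\<in>{P \<in> proj_points. P \<subseteq> W}. g P)"
proof -
  let ?T = "{P \<in> proj_points. P \<subseteq> W}"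
  have "(\<Sum>v\<in>W - {0}. g (vec.span {v}))
      = (\<Sum>P\<in>?T. \<Sum>v\<in>{v \<in> W - {0}. vec.span {v} = P}. g (vec.span {v}))"
    using W vec.span_minimal[of "{_}" W]
    by (intro sum.group[symmetric]) (auto simp: span_in_proj_points_iff)
  also have "\<dots> = (\<Sum>P\<in>?T. of_nat (CARD('a) - 1) * g P)"
  proof (rule sum.cong)
    fix P assume P: "P \<in> ?T"
    have "{v \<in> W - {0}. vec.span {v} = P} = P - {0}"
      using P span_eq_proj_point_iff[of P] by auto
    moreover have "0 \<in> P" using P by (auto simp: proj_points_def proj_subspaces_def vec.subspace_0)
    moreover have "card P = CARD('a)"
      using P card_proj_subspace[of P 0] by (simp add: proj_points_def)
    ultimately have "card {v \<in> W - {0}. vec.span {v} = P} = CARD('a) - 1"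
      by (simp add: card_Diff_singleton)
    then show "(\<Sum>v\<in>{v \<in> W - {0}. vec.span {v} = P}. g (vec.span {v})) = of_nat (CARD('a) - 1) * g P"
      by simp
  qed simp
  finally show ?thesis by (simp add: sum_distrib_left)
qed

lemma CHAR_eq_if_CARD_prime_power:
  assumes "prime p" "CARD('a::{field,finite}) = p ^ h" shows "CHAR('a) = p"
proof -
  have "(of_nat p :: 'a) ^ h = 0" using of_nat_CARD_eq_0[where 'a='a] assms(2) by simp
  then have "(of_nat p :: 'a) = 0" by simp
  then have "CHAR('a) dvd p" by (simp add: of_nat_eq_0_iff_char_dvd)
  then show ?thesis using assms(1) CHAR_not_1[where 'a='a] by (auto simp: prime_nat_iff)
qed

lemma incvec_span:
  assumes "vec.subspace W"
  shows "incvec W (vec.span {v}) = (if v \<in> W - {0} then 1 else 0)"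
proof -
  have "vec.span {v} \<subseteq> W \<longleftrightarrow> v \<in> W"
    using assms vec.span_base[of v "{v}"] vec.span_minimal[of "{v}" W] by blast
  then show ?thesis by (simp add: incvec_def span_in_proj_points_iff)
qed

text \<open>After exchanging the sums, each \<open>W\<close> contributes the number of nonzero
  vectors in \<open>U \<inter> W\<close>, which is -1 modulo \<open>p\<close> by
  \<open>card_dvd_card_ksub_Int\<close>.\<close>

lemma sum_codeword_subgroup:
  fixes a :: "('a::{field,finite} ^ 'n) set \<Rightarrow> int"
  assumes U: "fp.ksub U" and big: "CARD('a ^ 'n) < card U * CARD('a) ^ (k + 1)"
  shows "(\<Sum>v\<in>U. \<Sum>W\<in>proj_subspaces k. of_int (a W) * incvec W (vec.span {v}))
    = - (\<Sum>W\<in>proj_subspaces k. of_int (a W) :: 'a)"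
proof -
  have "(\<Sum>v\<in>U. incvec W (vec.span {v})) = (-1 :: 'a)" if W: "W \<in> proj_subspaces k" for W
  proof -
    have sub: "vec.subspace W" using W by (simp add: proj_subspaces_def)
    then have ksub: "fp.ksub W" by (simp add: fq_ksub_imp_fp_ksub fq_ksub_iff_subspace)
    have "(\<Sum>v\<in>U. incvec W (vec.span {v})) = (\<Sum>v\<in>U. if v \<in> W - {0} then 1 else 0 :: 'a)"
      by (simp only: incvec_span[OF sub])
    also have "\<dots> = of_nat (card (U \<inter> (W - {0})))"
      by (simp add: sum.If_cases Int_def)
    also have "U \<inter> (W - {0}) = U \<inter> W - {0}" by auto
    also have "card \<dots> = card (U \<inter> W) - 1"
      using fp.ksub_zero[OF U] fp.ksub_zero[OF ksub] by (simp add: card_Diff_singleton)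
    also have "of_nat (card (U \<inter> W) - 1) = (-1 :: 'a)"
    proof -
      have "CHAR('a) dvd card (U \<inter> W)"
        using fp.card_dvd_card_ksub_Int[OF U ksub] big card_proj_subspace[OF W] card_range_of_int[where 'a='a]
        by simp
      then have "of_nat (card (U \<inter> W)) = (0 :: 'a)" by (simp add: of_nat_eq_0_iff_char_dvd)
      moreover have "card (U \<inter> W) \<ge> 1"
        using fp.ksub_zero[OF U] fp.ksub_zero[OF ksub] by (auto simp: Suc_le_eq card_gt_0_iff)
      ultimately show ?thesis by (simp add: of_nat_diff)
    qed
    finally show ?thesis .
  qed
  then have "(\<Sum>W\<in>proj_subspaces k. \<Sum>v\<in>U. of_int (a W) * incvec W (vec.span {v}))
      = (\<Sum>W\<in>proj_subspaces k. - (of_int (a W) :: 'a))"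
    by (intro sum.cong) (simp_all flip: sum_distrib_left)
  then show ?thesis by (subst sum.swap) (simp add: sum_negf)
qed

theorem mainTheorem4:
  fixes c :: "('a::{field,finite} ^ 'n) set \<Rightarrow> 'a"
    and n k p h q :: nat
  assumes "CARD('n) = n + 1" and "n \<ge> 2"
    and "1 \<le> k" and "k \<le> n - 1"
    and "prime p" and "p > 5" and "h \<ge> 1" and "q = p ^ h"
    and "CARD('a) = q"
    and "c \<in> code k" and "c \<notin> dual_code (n - k)"
  shows "\<not> (theta q k < weight c \<and> weight c < 2 * q ^ k)"
proof
  assume w: "theta q k < weight c \<and> weight c < 2 * q ^ k"
  obtain a :: "('a ^ 'n) set \<Rightarrow> int"
    where c: "c = (\<lambda>P. \<Sum>W\<in>proj_subspaces k. of_int (a W) * incvec W P)"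
    using assms(10) by (auto simp: code_def)
  define \<alpha> :: 'a where "\<alpha> = (\<Sum>W\<in>proj_subspaces k. of_int (a W))"
  \<comment> \<open>The zero vector spans no point, so it receives the value 0.\<close>
  define F where "F v = c (vec.span {v})" for v
  note q = assms(9)
  have q2: "q \<ge> 2" using CARD_ge_2[where 'a='a] q by simp
  have n: "n = k + (n - k)" using assms(2-4) by linarith
  have neg1: "of_nat (q - 1) = (-1 :: 'a)"
    using of_nat_CARD_eq_0[where 'a='a] q q2 by (simp add: of_nat_diff)
  have off_points: "c P = 0" if "P \<notin> proj_points" for P
    using that by (simp add: c incvec_def)
  have F_0: "F 0 = 0"
    using off_points span_in_proj_points_iff[of "0 :: 'a ^ 'n"] by (simp only: F_def) blast
  have F_scale: "F (t *s v) = F v" if "t \<noteq> 0" for t v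
  proof -
    have "vec.span {t *s v} = vec.span {v}"
      using vec.span_image_scale[of "{v}" "\<lambda>_. t"] that by simp
    then show ?thesis by (simp add: F_def)
  qed
  have card_Z: "card {v. F v \<noteq> 0} = (q - 1) * weight c"
  proof -
    have "card {v. F v \<noteq> 0} = (\<Sum>v\<in>UNIV - {0}. if F v \<noteq> 0 then 1 else 0)"
      using F_0 by (subst sum.If_cases) (auto intro: arg_cong[where f = card])
    also have "\<dots> = (q - 1) * (\<Sum>P\<in>{P \<in> proj_points. P \<subseteq> UNIV}. if c P \<noteq> 0 then 1 else 0)"
      using sum_vectors_eq_sum_points[OF vec.subspace_UNIV, of "\<lambda>P. if c P \<noteq> 0 then 1 else 0 :: nat"] q
      by (simp add: F_def)
    also have "(\<Sum>P\<in>{P \<in> proj_points. P \<subseteq> UNIV}. if c P \<noteq> 0 then 1 else 0 :: nat) = weight c"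
      unfolding weight_def by (subst sum.If_cases) (auto intro: arg_cong[where f = card])
    finally show ?thesis .
  qed
  have sum_F: "sum F U = - \<alpha>" if U: "fp.ksub U" "q ^ (n - k) < card U" for U
  proof -
    have "CARD('a ^ 'n) = q ^ (n - k) * q ^ (k + 1)"
      using n assms(1) q by (simp flip: power_add)
    also have "\<dots> < card U * q ^ (k + 1)" using U q2 by simp
    finally show ?thesis
      using sum_codeword_subgroup[OF U(1), of k a] q by (simp add: F_def c \<alpha>_def)
  qed
  \<comment> \<open>Otherwise \<open>c\<close> would be orthogonal to every
    \<open>(n - k)\<close>-space and lie in the dual code.\<close>
  have "\<alpha> \<noteq> 0"
  proof
    assume "\<alpha> = 0"
    have "c P \<in> range of_int" for P
    proof -
      have "c P = of_int (\<Sum>W\<in>proj_subspaces k. a W * (if P \<in> proj_points \<and> P \<subseteq> W then 1 else 0))"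
        by (auto simp: c incvec_def intro!: sum.cong)
      then show ?thesis by blast
    qed
    then have "c \<in> ambient" using off_points by (simp add: ambient_def)
    then obtain W where W: "W \<in> proj_subspaces (n - k)" "(\<Sum>P\<in>proj_points. c P * incvec W P) \<noteq> 0"
      using assms(11) by (auto simp: dual_code_def)
    then have sub: "vec.subspace W" by (simp add: proj_subspaces_def)
    have "q ^ (n - k) < card W" using card_proj_subspace[OF W(1)] q q2 by simp
    then have "sum F W = 0"
      using sum_F[of W] sub \<open>\<alpha> = 0\<close> by (simp add: fq_ksub_imp_fp_ksub fq_ksub_iff_subspace)
    moreover have "sum F W = sum F (W - {0})"
      using F_0 by (intro sum.mono_neutral_right) auto
    moreover have "sum F (W - {0}) = - (\<Sum>P\<in>{P \<in> proj_points. P \<subseteq> W}. c P)"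
      using sum_vectors_eq_sum_points[OF sub, of c] neg1 q by (simp add: F_def)
    moreover have "(\<Sum>P\<in>{P \<in> proj_points. P \<subseteq> W}. c P) = (\<Sum>P\<in>proj_points. c P * incvec W P)"
      by (rule sum.mono_neutral_cong_left) (auto simp: incvec_def)
    ultimately show False using W(2) by simp
  qed
  then interpret light_codeword F \<alpha> k "n - k"
  proof (unfold_locales)
    show "CARD('n) = k + (n - k) + 1" "1 \<le> n - k" using assms(1-4) n by linarith+
    show "5 \<le> CHAR('a)" using CHAR_eq_if_CARD_prime_power[OF assms(5), where 'a='a] assms by simp
    show "card {v. F v \<noteq> 0} < 2 * CARD('a) ^ k * (CARD('a) - 1)"
      using w q q2 by (simp add: card_Z)
  qed (use F_scale F_0 sum_F q in auto)
  \<comment> \<open>Each point accounts for \<open>q - 1\<close> vectors of the support; dividing by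
    \<open>q - 1\<close> turns the bound into \<open>theta q k\<close>.\<close>
  have "weight c * (q - 1) \<le> q ^ (k + 1) - 1"
    using card_Z_le q by (simp add: card_Z mult.commute)
  then have "weight c \<le> theta q k"
    using q2 by (simp add: theta_def less_eq_div_iff_mult_less_eq)
  then show False using w by simp
qed

end
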